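(* Let $U$ be a finite set and let $\mathbb{Y}$ be a coherent preference list on $U$ with induced choice function $f=f_{\mathbb{Y}}$. Then $f$ is not substitutable if and only if there exist members $X,Y$ of $\mathbb{Y}$ with $X \succ Y$ and $f(X\cup Y)=X$ such that some $x \in X\setminus Y$ satisfies $f(Y\cup\{x\})=Y$ (i.e. there is a witness to non-substitutability).
   Context: A choice function on a finite set $U$ is a map $f$ from subsets of $U$ to subsets of $U$ with $f(A)\subseteq A$ for all $A\subseteq U$. It is substitutable if for all $A\subseteq B\subseteq U$ one has $f(B)\cap A\subseteq f(A)$. A preference list $\mathbb{Y}$ on $U$ is an ordered finite list of subsets of $U$ whose last element is the empty set; for members $X,Y$ we write $X\succ Y$ if $X$ properly precedes $Y$ in the list and $X\succeq Y$ if $X\succ Y$ or $X=Y$. The induced choice function $f_{\mathbb{Y}}$ maps $A\subseteq U$ to the first member of $\mathbb{Y}$ contained in $A$. $\mathbb{Y}$ is coherent if for any two members, $X\succ Y$ implies $X\not\subseteq Y$. A witness to non-substitutability is a pair $(X,Y)$ of members of $\mathbb{Y}$ with $X\succ Y$, $f(X\cup Y)=X$, and some $x\in X\setminus Y$ with $f(Y\cup\{x\})=Y$. *)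

theory Defs
  imports Main
begin

definition choice_function :: "'a set \<Rightarrow> ('a set \<Rightarrow> 'a set) \<Rightarrow> bool" where
  "choice_function U f \<longleftrightarrow> (\<forall>A. A \<subseteq> U \<longrightarrow> f A \<subseteq> A)"

definition substitutable :: "'a set \<Rightarrow> ('a set \<Rightarrow> 'a set) \<Rightarrow> bool" where
  "substitutable U f \<longleftrightarrow> (\<forall>A B. A \<subseteq> B \<and> B \<subseteq> U \<longrightarrow> f B \<inter> A \<subseteq> f A)"

definition preference_list :: "'a set \<Rightarrow> 'a set list \<Rightarrow> bool" where
  "preference_list U Ys \<longleftrightarrow> (\<forall>Y\<in>set Ys. Y \<subseteq> U) \<and> Ys \<noteq> [] \<and> last Ys = {}"

text \<open>Precedence is by position, so a set occurring twice in the list precedes itself;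
  coherence therefore rules out repetitions.\<close>

definition precedes :: "'a set list \<Rightarrow> 'a set \<Rightarrow> 'a set \<Rightarrow> bool" where
  "precedes Ys X Y \<longleftrightarrow> (\<exists>i j. i < j \<and> j < length Ys \<and> Ys ! i = X \<and> Ys ! j = Y)"

definition coherent :: "'a set list \<Rightarrow> bool" where
  "coherent Ys \<longleftrightarrow> (\<forall>X\<in>set Ys. \<forall>Y\<in>set Ys. precedes Ys X Y \<longrightarrow> \<not> X \<subseteq> Y)"

text \<open>For a preference list the search always succeeds, because the last member is empty.\<close>

definition induced_choice :: "'a set list \<Rightarrow> 'a set \<Rightarrow> 'a set" where
  "induced_choice Ys A = the (find (\<lambda>X. X \<subseteq> A) Ys)"

lemma choice_function_induced_choice:
  assumes "preference_list U Ys"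
  shows "choice_function U (induced_choice Ys)"
proof -
  have "{} \<in> set Ys"
    using assms last_in_set[of Ys] unfolding preference_list_def by auto
  then have "find (\<lambda>X. X \<subseteq> A) Ys \<noteq> None" for A
    unfolding find_None_iff by blast
  then show ?thesis
    unfolding choice_function_def induced_choice_def
    by (metis find_Some_iff option.exhaust_sel)
qed

end

theory Submission
  imports Defs
begin

text \<open>The induced choice function is consistent: if \<open>f A \<subseteq> C \<subseteq> A\<close>, then \<open>f C = f A\<close>. Hence a
  violation \<open>x \<in> f B \<inter> A - f A\<close> of substitutability, where \<open>A \<subseteq> B\<close>, shrinks to the sets
  \<open>f A \<union> {x} \<subseteq> f B \<union> f A\<close>, and \<open>X = f B\<close>, \<open>Y = f A\<close> is a witness. Conversely, a witness
  violates substitutability for \<open>Y \<union> {x} \<subseteq> X \<union> Y\<close>.\<close>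

text \<open>Turns \<open>find\<close> into a least index, so that later arguments only compare
  positions. The search succeeds because \<open>{}\<close> is a member.\<close>

lemma induced_choice_nth:
  assumes "preference_list U Ys"
  obtains i where "i < length Ys" "induced_choice Ys A = Ys ! i" "Ys ! i \<subseteq> A"
    "\<And>j. j < i \<Longrightarrow> \<not> Ys ! j \<subseteq> A"
proof -
  have "{} \<in> set Ys"
    using assms last_in_set[of Ys] unfolding preference_list_def by auto
  then have "find (\<lambda>X. X \<subseteq> A) Ys \<noteq> None"
    unfolding find_None_iff by blast
  then obtain X where X: "find (\<lambda>X. X \<subseteq> A) Ys = Some X"
    by blast
  then obtain i where "i < length Ys" "Ys ! i \<subseteq> A" "X = Ys ! i" "\<forall>j<i. \<not> Ys ! j \<subseteq> A"
    by (auto simp: find_Some_iff)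
  moreover have "induced_choice Ys A = X"
    using X by (simp add: induced_choice_def)
  ultimately show thesis
    using that by blast
qed

lemma induced_choice_in_set:
  assumes "preference_list U Ys"
  shows "induced_choice Ys A \<in> set Ys"
  using induced_choice_nth[OF assms, of A] by (metis nth_mem)

lemma induced_choice_subset:
  assumes "preference_list U Ys"
  shows "induced_choice Ys A \<subseteq> A"
  using induced_choice_nth[OF assms, of A] by metis

lemma induced_choice_precedes:
  assumes "preference_list U Ys" and "Y \<in> set Ys" and "Y \<subseteq> A" and "Y \<noteq> induced_choice Ys A"
  shows "precedes Ys (induced_choice Ys A) Y"
proof -
  obtain i where i: "induced_choice Ys A = Ys ! i" "\<And>j. j < i \<Longrightarrow> \<not> Ys ! j \<subseteq> A"
    using induced_choice_nth[OF assms(1), of A] by metis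
  obtain j where j: "j < length Ys" "Ys ! j = Y"
    using assms(2) by (auto simp: in_set_conv_nth)
  then have "i < j"
    using i assms(3,4) by (metis linorder_neqE_nat)
  then show ?thesis
    using i j unfolding precedes_def by blast
qed

text \<open>Shrinking \<open>A\<close> to \<open>C\<close> keeps the chosen member available and
  makes no earlier member available.\<close>

lemma induced_choice_consistent:
  assumes "preference_list U Ys" and "induced_choice Ys A \<subseteq> C" and "C \<subseteq> A"
  shows "induced_choice Ys C = induced_choice Ys A"
proof -
  obtain i where i: "induced_choice Ys A = Ys ! i" "\<And>j. j < i \<Longrightarrow> \<not> Ys ! j \<subseteq> A"
    using induced_choice_nth[OF assms(1), of A] by metis
  obtain k where k: "induced_choice Ys C = Ys ! k" "Ys ! k \<subseteq> C"
    "\<And>j. j < k \<Longrightarrow> \<not> Ys ! j \<subseteq> C"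
    using induced_choice_nth[OF assms(1), of C] by metis
  \<comment> \<open>\<open>k < i\<close> fails since
    \<open>Ys ! k \<subseteq> C \<subseteq> A\<close>, and \<open>i < k\<close> fails since
    \<open>Ys ! i \<subseteq> C\<close>.\<close>
  have "i = k"
    using i k assms(2,3) by (metis linorder_neqE_nat subset_trans)
  then show ?thesis
    using i k by simp
qed

theorem theorem1:
  fixes U :: "'a set" and Ys :: "'a set list" and f :: "'a set \<Rightarrow> 'a set"
  assumes "finite U"
    and "preference_list U Ys"
    and "coherent Ys"
    and "f = induced_choice Ys"
  shows "\<not> substitutable U f \<longleftrightarrow>
    (\<exists>X\<in>set Ys. \<exists>Y\<in>set Ys. precedes Ys X Y \<and> f (X \<union> Y) = X \<and>
      (\<exists>x\<in>X - Y. f (Y \<union> {x}) = Y))"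
    (is "_ \<longleftrightarrow> ?witness")
proof
  assume "\<not> substitutable U f"
  then obtain A B x where AB: "A \<subseteq> B" and x: "x \<in> f B" "x \<in> A" "x \<notin> f A"
    unfolding substitutable_def by blast
  have sub: "f A \<subseteq> A" "f B \<subseteq> B"
    using induced_choice_subset assms(2,4) by metis+
  have mem: "f A \<in> set Ys" "f B \<in> set Ys"
    using induced_choice_in_set assms(2,4) by metis+
  \<comment> \<open>\<open>f A\<close> competes in the choice from \<open>B\<close>, as
    \<open>f A \<subseteq> A \<subseteq> B\<close>, and it loses: \<open>x\<close> separates it from
    \<open>f B\<close>.\<close>
  have "precedes Ys (f B) (f A)"
    using induced_choice_precedes[OF assms(2), of "f A" B] mem sub AB x assms(4) by auto
  moreover have "f (f B \<union> f A) = f B"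
    using induced_choice_consistent[OF assms(2), of B "f B \<union> f A"] sub AB assms(4) by auto
  moreover have "f (f A \<union> {x}) = f A"
    using induced_choice_consistent[OF assms(2), of A "f A \<union> {x}"] sub x assms(4) by auto
  ultimately show ?witness
    using mem x by blast
next
  assume ?witness
  then obtain X Y x where XY: "X \<in> set Ys" "Y \<in> set Ys" "f (X \<union> Y) = X"
    and x: "x \<in> X - Y" "f (Y \<union> {x}) = Y"
    by blast
  have "X \<union> Y \<subseteq> U"
    using XY assms(2) unfolding preference_list_def by blast
  \<comment> \<open>The violating element is \<open>x\<close>: it lies in
    \<open>X = f (X \<union> Y)\<close> but not in \<open>Y = f (Y \<union> {x})\<close>.\<close>
  moreover have "Y \<union> {x} \<subseteq> X \<union> Y" "\<not> f (X \<union> Y) \<inter> (Y \<union> {x}) \<subseteq> f (Y \<union> {x})"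
    using XY(3) x by auto
  ultimately show "\<not> substitutable U f"
    unfolding substitutable_def by blast
qed

end
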